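(* Let $n\ge1$ be an integer. If $k>0$, then $$\epsilon_{q,n}(k) = \sum_{r=0}^k \epsilon_{1,n}(r)\, p_{q, n}(k-r).$$
   Context: $q$ is an indeterminate. $\mathcal P(n)$ is the set of multi-partitions $\mathbf p=(\rho^{(1)},\dots,\rho^{(n)})$ with $n$ components, each a (possibly empty) partition, and $|\mathbf p|=|\rho^{(1)}|+\cdots+|\rho^{(n)}|$. For a partition $\mathbf q=(1^{m_1}2^{m_2}\cdots)$ put $\kappa_q(\mathbf q)=(-q^{-1})^{\sum_r m_r}$ if every $m_r\in\{0,1\}$ and $\kappa_q(\mathbf q)=0$ otherwise, and $d(\mathbf q)=\#\{r: m_r\ne0\}$. For $\mathbf p\in\mathcal P(n)$ put $\kappa_q(\mathbf p)=\prod_{i=1}^n\kappa_q(\rho^{(i)})$ and $d(\mathbf p)=\sum_{i=1}^nd(\rho^{(i)})$. For $k\ge1$ define $$\epsilon_{q,n}(k)=\sum_{\mathbf p\in\mathcal P(n),\,|\mathbf p|=k}\kappa_q(\mathbf p),\qquad p_{q,n}(k)=\sum_{\mathbf p\in\mathcal P(n),\,|\mathbf p|=k}(1-q^{-1})^{d(\mathbf p)},$$ and $\epsilon_{q,n}(0)=p_{q,n}(0)=1$. Equivalently $\prod_{k\ge1}(1-q^{-1}t^k)^n=\sum_{k\ge0}\epsilon_{q,n}(k)t^k$. $\epsilon_{1,n}$ is the value at $q=1$. *)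

theory Defs
  imports
    "HOL-Library.Multiset"
    "HOL-Computational_Algebra.Polynomial_Factorial"
begin

text \<open>A partition is the multiset of its (positive) parts, so the multiplicity \<open>m_r\<close> of the
  part \<open>r\<close> is \<open>count \<rho> r\<close>, the number of parts is \<open>size \<rho>\<close>, and \<open>|\<rho>|\<close> is \<open>sum_mset \<rho>\<close>.\<close>

definition is_partition :: "nat multiset \<Rightarrow> bool" where
  "is_partition \<rho> \<longleftrightarrow> 0 \<notin># \<rho>"

definition multipartitions :: "nat \<Rightarrow> nat multiset list set" where
  "multipartitions n = {ps. length ps = n \<and> (\<forall>\<rho>\<in>set ps. is_partition \<rho>)}"

definition weight :: "nat multiset list \<Rightarrow> nat" where
  "weight ps = (\<Sum>\<rho>\<leftarrow>ps. sum_mset \<rho>)"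

definition multipartitions_of :: "nat \<Rightarrow> nat \<Rightarrow> nat multiset list set" where
  "multipartitions_of n k = {ps \<in> multipartitions n. weight ps = k}"

text \<open>The quantities below are given by formulas polynomial in \<open>q\<^sup>-\<^sup>1\<close>; they are defined for an
  arbitrary element \<open>q\<close> of a field, so that they can be used both at the indeterminate and at
  \<open>q = 1\<close>.\<close>

definition kappa1 :: "'a::field \<Rightarrow> nat multiset \<Rightarrow> 'a" where
  "kappa1 q \<rho> = (if \<forall>r. count \<rho> r \<in> {0, 1} then (- inverse q) ^ size \<rho> else 0)"

definition kappa :: "'a::field \<Rightarrow> nat multiset list \<Rightarrow> 'a" where
  "kappa q ps = (\<Prod>\<rho>\<leftarrow>ps. kappa1 q \<rho>)"

definition d1 :: "nat multiset \<Rightarrow> nat" where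
  "d1 \<rho> = card {r. count \<rho> r \<noteq> 0}"

definition d :: "nat multiset list \<Rightarrow> nat" where
  "d ps = (\<Sum>\<rho>\<leftarrow>ps. d1 \<rho>)"

definition epsilon :: "'a::field \<Rightarrow> nat \<Rightarrow> nat \<Rightarrow> 'a" where
  "epsilon q n k = (if k = 0 then 1 else (\<Sum>ps\<in>multipartitions_of n k. kappa q ps))"

definition p_sum :: "'a::field \<Rightarrow> nat \<Rightarrow> nat \<Rightarrow> 'a" where
  "p_sum q n k = (if k = 0 then 1 else (\<Sum>ps\<in>multipartitions_of n k. (1 - inverse q) ^ d ps))"

text \<open>The indeterminate, as an element of the field of rational functions over an integral
  domain of coefficients.\<close>

definition indet :: "'a::idom poly fract" where
  "indet = to_fract [:0, 1:]"

text \<open>The sums above range over finite sets, so none of them is zero by convention.\<close>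

lemma finite_multipartitions_of: "finite (multipartitions_of n k)"
proof -
  let ?M = "{\<rho>. set_mset \<rho> \<subseteq> {..k} \<and> size \<rho> \<le> k}"
  have "?M \<subseteq> mset ` {xs. set xs \<subseteq> {..k} \<and> length xs \<le> k}"
  proof
    fix \<rho> assume "\<rho> \<in> ?M"
    moreover obtain xs where "mset xs = \<rho>" using ex_mset by blast
    ultimately show "\<rho> \<in> mset ` {xs. set xs \<subseteq> {..k} \<and> length xs \<le> k}" by force
  qed
  then have fin: "finite ?M"
    using finite_lists_length_le[of "{..k}" k] by (meson finite_atMost finite_imageI finite_subset)
  have size: "size \<rho> \<le> sum_mset \<rho>" if "0 \<notin># \<rho>" for \<rho> :: "nat multiset"
    using that by (induction \<rho>) auto
  have elem: "x \<le> sum_mset \<rho>" if "x \<in># \<rho>" for x and \<rho> :: "nat multiset"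
    using that by (induction \<rho>) (auto intro: trans_le_add1 trans_le_add2)
  have "multipartitions_of n k \<subseteq> {ps. set ps \<subseteq> ?M \<and> length ps = n}"
  proof
    fix ps assume ps: "ps \<in> multipartitions_of n k"
    have "\<rho> \<in> ?M" if "\<rho> \<in> set ps" for \<rho>
    proof -
      have "sum_mset \<rho> \<le> k"
        using ps that member_le_sum_list[of "sum_mset \<rho>" "map sum_mset ps"]
        by (auto simp: multipartitions_of_def weight_def)
      moreover have "0 \<notin># \<rho>"
        using ps that by (auto simp: multipartitions_of_def multipartitions_def is_partition_def)
      ultimately show ?thesis
        using size[of \<rho>] elem[of _ \<rho>] by (fastforce dest: order_trans)
    qed
    then show "ps \<in> {ps. set ps \<subseteq> ?M \<and> length ps = n}"
      using ps by (auto simp: multipartitions_of_def multipartitions_def)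
  qed
  then show ?thesis
    using finite_lists_length_eq[OF fin, of n] finite_subset by blast
qed

text \<open>Setting the parameter to \<open>1\<close> agrees with evaluating at \<open>1\<close> the Laurent polynomial obtained
  at the indeterminate.\<close>

definition has_value_at_1 :: "'a::idom poly fract \<Rightarrow> 'a poly fract \<Rightarrow> bool" where
  "has_value_at_1 f c \<longleftrightarrow> (\<exists>a N. f = to_fract a / indet ^ N \<and> c = to_fract [:poly a 1:])"

lemma indet_nonzero [simp]: "indet \<noteq> 0"
  by (simp add: indet_def)

lemma has_value_at_1_const: "has_value_at_1 (to_fract [:x:]) (to_fract [:x:])"
  unfolding has_value_at_1_def by (rule exI[of _ "[:x:]"], rule exI[of _ 0]) simp

lemma has_value_at_1_add:
  assumes "has_value_at_1 f c" "has_value_at_1 g e"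
  shows "has_value_at_1 (f + g) (c + e)"
proof -
  obtain a N b M where *: "f = to_fract a / indet ^ N" "c = to_fract [:poly a 1:]"
    "g = to_fract b / indet ^ M" "e = to_fract [:poly b 1:]"
    using assms unfolding has_value_at_1_def by blast
  have pow: "to_fract ([:0, 1:] ^ K) = (indet :: 'a poly fract) ^ K" for K
    by (induction K) (simp_all add: indet_def del: mult_pCons_left mult_pCons_right)
  have "f + g = to_fract (a * [:0, 1:] ^ M + b * [:0, 1:] ^ N) / indet ^ (N + M)"
    by (simp add: * pow field_simps power_add)
  moreover have "c + e = to_fract [:poly (a * [:0, 1:] ^ M + b * [:0, 1:] ^ N) 1:]"
    by (simp add: * flip: to_fract_add)
  ultimately show ?thesis
    unfolding has_value_at_1_def by blast
qed

lemma has_value_at_1_mult: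
  assumes "has_value_at_1 f c" "has_value_at_1 g e"
  shows "has_value_at_1 (f * g) (c * e)"
proof -
  obtain a N b M where *: "f = to_fract a / indet ^ N" "c = to_fract [:poly a 1:]"
    "g = to_fract b / indet ^ M" "e = to_fract [:poly b 1:]"
    using assms unfolding has_value_at_1_def by blast
  have "f * g = to_fract (a * b) / indet ^ (N + M)"
    by (simp add: * power_add)
  moreover have "c * e = to_fract [:poly (a * b) 1:]"
    by (simp add: * flip: to_fract_mult)
  ultimately show ?thesis
    unfolding has_value_at_1_def by blast
qed

lemma has_value_at_1_epsilon:
  "has_value_at_1 (epsilon (indet :: 'a::idom poly fract) n k) (epsilon 1 n k)"
proof -
  let ?q = "indet :: 'a poly fract"
  have 0: "has_value_at_1 (0 :: 'a poly fract) 0" and 1: "has_value_at_1 (1 :: 'a poly fract) 1"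
    using has_value_at_1_const[of 0] has_value_at_1_const[of 1] by (simp_all flip: one_pCons)
  have "has_value_at_1 (inverse ?q) 1"
    unfolding has_value_at_1_def
    by (rule exI[of _ 1], rule exI[of _ 1]) (simp add: field_simps flip: one_pCons)
  moreover have minus: "to_fract [:- 1 :: 'a:] = - 1"
    by (metis minus_pCons one_pCons minus_zero to_fract_1 to_fract_uminus)
  ultimately have m: "has_value_at_1 (- inverse ?q) (- 1)"
    using has_value_at_1_mult[OF has_value_at_1_const[of "- 1 :: 'a"], of "inverse ?q" 1]
    by (simp add: minus)
  have pow: "has_value_at_1 ((- inverse ?q) ^ j) ((- 1) ^ j)" for j
    by (induction j) (simp_all only: power_0 power_Suc 1 has_value_at_1_mult[OF m])
  have kappa1: "has_value_at_1 (kappa1 ?q \<rho>) (kappa1 1 \<rho>)" for \<rho>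
    unfolding kappa1_def inverse_1 using pow 0 by presburger
  have kappa: "has_value_at_1 (kappa ?q ps) (kappa 1 ps)" for ps
    by (induction ps) (auto simp: kappa_def 1 intro: has_value_at_1_mult kappa1)
  have "has_value_at_1 (\<Sum>ps\<in>A. kappa ?q ps) (\<Sum>ps\<in>A. kappa 1 ps)" for A
    by (induction A rule: infinite_finite_induct) (auto simp: 0 intro: has_value_at_1_add kappa)
  then show ?thesis
    by (simp add: epsilon_def 1)
qed

end

theory Submission
  imports Defs "HOL-Computational_Algebra.Formal_Power_Series"
begin

unbundle fps_syntax

text \<open>With \<open>x = q\<^sup>-\<^sup>1\<close>, the generating function of \<open>\<epsilon>\<close> is \<open>\<Prod>r. (1 - x t\<^sup>r)\<^sup>n\<close>, and since
  \<open>1 + (1 - x) (t\<^sup>r + t\<^sup>2\<^sup>r + \<dots>) = (1 - x t\<^sup>r) / (1 - t\<^sup>r)\<close>, that of \<open>p\<close> is its quotient by the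
  generating function of \<open>\<epsilon>\<close> at \<open>q = 1\<close>. Infinite products are avoided: up to degree \<open>k\<close> only the
  parts \<open>r \<le> k\<close> matter.\<close>

section \<open>Generating functions of partitions and their local factors\<close>

definition partitions_into :: "nat set \<Rightarrow> nat \<Rightarrow> nat multiset set" where
  "partitions_into S k = {\<rho>. set_mset \<rho> \<subseteq> S \<and> sum_mset \<rho> = k}"

definition partition_gf :: "nat set \<Rightarrow> (nat multiset \<Rightarrow> 'a) \<Rightarrow> 'a::field fps" where
  "partition_gf S w = Abs_fps (\<lambda>k. \<Sum>\<rho>\<in>partitions_into S k. w \<rho>)"

text \<open>The local factor of the part \<open>r\<close>: the sum of \<open>f m\<close> t^(r m)
  over all multiplicities m of \<open>r\<close>.\<close>

definition part_gf :: "nat \<Rightarrow> (nat \<Rightarrow> 'a) \<Rightarrow> 'a::field fps" where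
  "part_gf r f = Abs_fps (\<lambda>j. if r dvd j then f (j div r) else 0)"

lemma partition_gf_nth: "partition_gf S w $ k = (\<Sum>\<rho>\<in>partitions_into S k. w \<rho>)"
  by (simp add: partition_gf_def)

text \<open>Parts \<open>0\<close> could be repeated freely without changing the sum, hence the
  hypothesis on \<open>S\<close>. Partitions are embedded as multi-partitions with one
  component.\<close>

lemma finite_partitions_into:
  assumes "0 \<notin> S"
  shows "finite (partitions_into S k)"
proof -
  have "(\<lambda>\<rho>. [\<rho>]) ` partitions_into S k \<subseteq> multipartitions_of 1 k"
    using assms by (auto simp: partitions_into_def multipartitions_of_def multipartitions_def
        is_partition_def weight_def)
  then have "finite ((\<lambda>\<rho>. [\<rho>]) ` partitions_into S k)"
    using finite_multipartitions_of finite_subset by blast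
  then show ?thesis
    by (rule finite_imageD) (simp add: inj_on_def)
qed

text \<open>Removing all copies of \<open>r\<close> leaves a partition with parts in
  \<open>S\<close>, and the multiplicity of \<open>r\<close> can be chosen independently. The weight
  is a product over multiplicities, so it splits in the same way and yields a Cauchy
  product.\<close>

lemma partition_gf_insert:
  fixes f :: "nat \<Rightarrow> 'a::field"
  assumes "finite S" "r \<notin> S" "0 \<notin> insert r S"
  shows "partition_gf (insert r S) (\<lambda>\<rho>. \<Prod>s\<in>insert r S. f (count \<rho> s)) =
    partition_gf S (\<lambda>\<rho>. \<Prod>s\<in>S. f (count \<rho> s)) * part_gf r f"
proof (rule fps_ext)
  fix k
  define w where "w \<rho> = (\<Prod>s\<in>S. f (count \<rho> s))" for \<rho>
  define B where "B = (SIGMA i:{0..k}. partitions_into S i)"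
  have r: "r > 0" using assms by auto
  have split: "filter_mset (\<lambda>s. s \<noteq> r) \<rho> + replicate_mset (count \<rho> r) r = \<rho>"
    "sum_mset (filter_mset (\<lambda>s. s \<noteq> r) \<rho>) + r * count \<rho> r = sum_mset \<rho>" for \<rho>
  proof -
    show *: "filter_mset (\<lambda>s. s \<noteq> r) \<rho> + replicate_mset (count \<rho> r) r = \<rho>"
      by (rule multiset_eqI) auto
    show "sum_mset (filter_mset (\<lambda>s. s \<noteq> r) \<rho>) + r * count \<rho> r = sum_mset \<rho>"
      using arg_cong[OF *, of sum_mset]
      by (simp only: sum_mset.union sum_mset_replicate_mset of_nat_id mult.commute)
  qed
  have fin: "finite B"
    unfolding B_def using assms by (auto intro: finite_partitions_into)
  have "(partition_gf S w * part_gf r f) $ k =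
      (\<Sum>i=0..k. \<Sum>\<rho>\<in>partitions_into S i. if r dvd k - i then w \<rho> * f ((k - i) div r) else 0)"
    by (auto simp: fps_mult_nth partition_gf_def part_gf_def sum_distrib_right intro!: sum.cong)
  also have "\<dots> = (\<Sum>(i, \<rho>)\<in>B. if r dvd k - i then w \<rho> * f ((k - i) div r) else 0)"
    unfolding B_def using assms by (subst sum.Sigma) (auto intro: finite_partitions_into)
  \<comment> \<open>Terms with \<open>k - i\<close> not divisible by \<open>r\<close> vanish. In the
    others the quotient serves as the multiplicity of \<open>r\<close>, which makes the remaining
    pairs correspond to partitions of \<open>k\<close>.\<close>
  also have "\<dots> = (\<Sum>(i, \<rho>)\<in>{(i, \<rho>)\<in>B. r dvd k - i}. w \<rho> * f ((k - i) div r))"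
    using fin by (intro sum.mono_neutral_cong_right) (auto split: if_splits)
  also have "\<dots> = (\<Sum>\<rho>\<in>partitions_into (insert r S) k. \<Prod>s\<in>insert r S. f (count \<rho> s))"
  proof (rule sum.reindex_bij_witness
      [where i = "\<lambda>\<rho>. (k - r * count \<rho> r, filter_mset (\<lambda>s. s \<noteq> r) \<rho>)"
         and j = "\<lambda>(i, \<rho>). \<rho> + replicate_mset ((k - i) div r) r"], goal_cases)
    case (1 a)
    obtain i \<rho> where a: "a = (i, \<rho>)" by force
    from 1 a have *: "i \<le> k" "set_mset \<rho> \<subseteq> S" "sum_mset \<rho> = i" "r dvd k - i"
      by (auto simp: B_def partitions_into_def)
    have "r \<notin># \<rho>" using * assms by auto
    then have "count \<rho> r = 0" by (simp add: count_eq_zero_iff)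
    moreover from this have "filter_mset (\<lambda>s. s \<noteq> r) \<rho> = \<rho>"
      by (intro multiset_eqI) simp
    ultimately show ?case using * r a by auto
  next
    case (2 a)
    obtain i \<rho> where a: "a = (i, \<rho>)" by force
    from 2 a have *: "i \<le> k" "set_mset \<rho> \<subseteq> S" "sum_mset \<rho> = i" "r dvd k - i"
      by (auto simp: B_def partitions_into_def)
    then show ?case
      using a r by (auto simp: partitions_into_def split: if_splits)
  next
    case (3 \<rho>)
    then have "sum_mset \<rho> = k" by (simp add: partitions_into_def)
    \<comment> \<open>The copies of \<open>r\<close> contribute at most \<open>k\<close> to the sum,
      so truncated subtraction loses nothing.\<close>
    then have "k - (k - r * count \<rho> r) = r * count \<rho> r"
      using split(2)[of \<rho>] by linarith
    then show ?case using r by (simp add: split(1))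
  next
    case (4 \<rho>)
    then have "sum_mset \<rho> = k" by (simp add: partitions_into_def)
    then have "k - (k - r * count \<rho> r) = r * count \<rho> r"
         "sum_mset (filter_mset (\<lambda>s. s \<noteq> r) \<rho>) = k - r * count \<rho> r"
      using split(2)[of \<rho>] by linarith+
    then show ?case using 4 by (auto simp: B_def partitions_into_def)
  next
    case (5 a)
    obtain i \<rho> where a: "a = (i, \<rho>)" by force
    from 5 a have *: "set_mset \<rho> \<subseteq> S"
      by (auto simp: B_def partitions_into_def)
    then have "count \<rho> r = 0" using assms by (auto simp: count_eq_zero_iff)
    moreover have "(\<Prod>s\<in>S. f (count (\<rho> + replicate_mset ((k - i) div r) r) s)) = w \<rho>"
      unfolding w_def using assms by (intro prod.cong) auto
    ultimately show ?case using a assms by (simp add: mult.commute)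
  qed
  finally show "partition_gf (insert r S) (\<lambda>\<rho>. \<Prod>s\<in>insert r S. f (count \<rho> s)) $ k =
    (partition_gf S (\<lambda>\<rho>. \<Prod>s\<in>S. f (count \<rho> s)) * part_gf r f) $ k"
    by (simp add: partition_gf_def w_def)
qed

text \<open>Multiplicities of different parts are independent, so the parts can be adjoined one at a
  time.\<close>

lemma partition_gf_prod:
  fixes f :: "nat \<Rightarrow> 'a::field"
  assumes "finite S" "0 \<notin> S"
  shows "partition_gf S (\<lambda>\<rho>. \<Prod>s\<in>S. f (count \<rho> s)) = (\<Prod>r\<in>S. part_gf r f)"
  using assms
proof (induction S)
  case empty
  have "partitions_into {} k = (if k = 0 then {{#}} else {})" for k
    by (auto simp: partitions_into_def)
  then show ?case
    by (auto simp: fps_eq_iff partition_gf_def)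
next
  case (insert r S)
  then show ?case
    \<comment> \<open>\<open>prod.insert\<close> is held back so that the weight still matches
      \<open>partition_gf_insert\<close>; the second call expands the product on the right.\<close>
    by (simp add: partition_gf_insert mult.commute del: prod.insert)
      (simp add: mult.commute)
qed

text \<open>Multiplicities above 1 have weight 0, so the series breaks off after the term in
  t^r.\<close>

lemma part_gf_kappa:
  assumes "r > 0"
  shows "part_gf r (\<lambda>m. if m \<in> {0, 1} then (- x) ^ m else 0) = 1 - fps_const x * fps_X ^ r"
  using assms
  by (intro fps_ext) (auto simp: part_gf_def fps_X_power_nth elim!: dvdE)

text \<open>Multiplying by \<open>1 - fps_X ^ r\<close> takes differences of coefficients at
  distance \<open>r\<close>. The weights 1, 1 - x, 1 - x, ... are constant from multiplicity 1 on,
  so only 1 and -x survive.\<close>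

lemma part_gf_d:
  assumes "r > 0"
  shows "(1 - fps_X ^ r) * part_gf r (\<lambda>m. if m = 0 then 1 else 1 - x) =
    1 - fps_const x * fps_X ^ r"
proof (rule fps_ext)
  fix k
  show "((1 - fps_X ^ r) * part_gf r (\<lambda>m. if m = 0 then 1 else 1 - x)) $ k =
      (1 - fps_const x * fps_X ^ r) $ k"
  proof (cases "k < r")
    case True
    then show ?thesis
      by (auto simp: left_diff_distrib fps_X_power_mult_nth part_gf_def fps_X_power_nth
          dest: dvd_imp_le)
  next
    case False
    then obtain j where "k = r + j"
      by (metis le_Suc_ex not_less)
    then show ?thesis
      using assms
      by (auto simp: left_diff_distrib fps_X_power_mult_nth part_gf_def fps_X_power_nth
          dvd_div_eq_0_iff)
  qed
qed

text \<open>Brings \<open>kappa1\<close> into the form that \<open>partition_gf_prod\<close>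
  accepts. Parts outside \<open>S\<close> have multiplicity 0, and the exponents of the factors add
  up to \<open>size \<rho>\<close>.\<close>

lemma kappa1_eq_prod:
  assumes "finite S" "set_mset \<rho> \<subseteq> S"
  shows "kappa1 q \<rho> =
    (\<Prod>r\<in>S. if count \<rho> r \<in> {0, 1} then (- inverse q) ^ count \<rho> r else 0)"
proof (cases "\<forall>r. count \<rho> r \<in> {0, 1}")
  case True
  have "size \<rho> = (\<Sum>r\<in>S. count \<rho> r)"
    unfolding size_multiset_overloaded_eq using assms
    by (intro sum.mono_neutral_left) (auto simp: not_in_iff)
  then show ?thesis
    using True by (simp add: kappa1_def power_sum)
next
  case False
  \<comment> \<open>A repeated part lies in \<open>S\<close> and supplies a zero factor.\<close>
  then obtain r where r: "count \<rho> r \<notin> {0, 1}" by blast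
  then have "r \<in> S" using assms(2) by (auto simp: count_eq_zero_iff)
  then show ?thesis
    unfolding kappa1_def if_not_P[OF False] using r assms(1)
    by (intro prod_zero[symmetric] bexI[of _ r]) auto
qed

text \<open>Each distinct part contributes one factor \<open>y\<close>, whatever its
  multiplicity.\<close>

lemma d1_power_eq_prod:
  fixes y :: "'a::field"
  assumes "finite S" "set_mset \<rho> \<subseteq> S"
  shows "y ^ d1 \<rho> = (\<Prod>r\<in>S. if count \<rho> r = 0 then 1 else y)"
proof -
  have "{r. count \<rho> r \<noteq> 0} = {r \<in> S. count \<rho> r \<noteq> 0}"
    using assms(2) by (auto simp: count_eq_zero_iff)
  then have "d1 \<rho> = card {r \<in> S. count \<rho> r \<noteq> 0}"
    by (simp only: d1_def)
  then show ?thesis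
    using assms(1) by (simp add: prod.If_cases Int_def)
qed

section \<open>The factorisation for single partitions, first with finitely many parts\<close>

lemma partition_gf_cong:
  assumes "\<And>\<rho>. set_mset \<rho> \<subseteq> S \<Longrightarrow> v \<rho> = w \<rho>"
  shows "partition_gf S v = partition_gf S w"
  using assms by (auto simp: partition_gf_def partitions_into_def fps_eq_iff intro!: sum.cong)

lemma partition_gf_kappa1_finite:
  fixes q :: "'a::field"
  assumes "finite S" "0 \<notin> S"
  shows "partition_gf S (kappa1 q) =
    partition_gf S (kappa1 1) * partition_gf S (\<lambda>\<rho>. (1 - inverse q) ^ d1 \<rho>)"
proof -
  \<comment> \<open>Stated for every \<open>q\<close>, because it is used both at the given
    \<open>q\<close> and at \<open>1\<close>, where the factors become 1 - t^r.\<close>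
  have kappa: "partition_gf S (kappa1 q) = (\<Prod>r\<in>S. 1 - fps_const (inverse q) * fps_X ^ r)"
    for q :: 'a
  proof -
    have "partition_gf S (kappa1 q) = partition_gf S
        (\<lambda>\<rho>. \<Prod>r\<in>S. if count \<rho> r \<in> {0, 1} then (- inverse q) ^ count \<rho> r else 0)"
      by (intro partition_gf_cong kappa1_eq_prod assms)
    also have "\<dots> = (\<Prod>r\<in>S. part_gf r (\<lambda>m. if m \<in> {0, 1} then (- inverse q) ^ m else 0))"
      by (intro partition_gf_prod assms)
    also have "\<dots> = (\<Prod>r\<in>S. 1 - fps_const (inverse q) * fps_X ^ r)"
      using assms by (intro prod.cong refl part_gf_kappa) (metis gr0I)
    finally show ?thesis .
  qed
  have "partition_gf S (\<lambda>\<rho>. (1 - inverse q) ^ d1 \<rho>) =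
      partition_gf S (\<lambda>\<rho>. \<Prod>r\<in>S. if count \<rho> r = 0 then 1 else 1 - inverse q)"
    by (intro partition_gf_cong d1_power_eq_prod assms)
  also have "\<dots> = (\<Prod>r\<in>S. part_gf r (\<lambda>m. if m = 0 then 1 else 1 - inverse q))"
    by (intro partition_gf_prod assms)
  finally have "partition_gf S (kappa1 1) * partition_gf S (\<lambda>\<rho>. (1 - inverse q) ^ d1 \<rho>) =
      (\<Prod>r\<in>S. (1 - fps_X ^ r) * part_gf r (\<lambda>m. if m = 0 then 1 else 1 - inverse q))"
    by (simp add: kappa prod.distrib)
  also have "\<dots> = (\<Prod>r\<in>S. 1 - fps_const (inverse q) * fps_X ^ r)"
    using assms by (intro prod.cong refl part_gf_d) (metis gr0I)
  finally show ?thesis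
    by (simp add: kappa)
qed

text \<open>No part of a partition of \<open>i\<close> exceeds \<open>i\<close>.\<close>

lemma partition_gf_nth_truncate:
  assumes "i \<le> k"
  shows "partition_gf {0<..} w $ i = partition_gf {0<..k} w $ i"
proof -
  have "x \<le> sum_mset \<rho>" if "x \<in># \<rho>" for x :: nat and \<rho>
    using that by (metis le_add1 multi_member_split sum_mset.add_mset)
  then have "partitions_into {0<..} i = partitions_into {0<..k} i"
    using assms by (fastforce simp: partitions_into_def)
  then show ?thesis
    by (simp add: partition_gf_def)
qed

lemma partition_gf_kappa1:
  fixes q :: "'a::field"
  shows "partition_gf {0<..} (kappa1 q) =
    partition_gf {0<..} (kappa1 1) * partition_gf {0<..} (\<lambda>\<rho>. (1 - inverse q) ^ d1 \<rho>)"
proof (rule fps_ext)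
  fix k
  show "partition_gf {0<..} (kappa1 q) $ k =
      (partition_gf {0<..} (kappa1 1) * partition_gf {0<..} (\<lambda>\<rho>. (1 - inverse q) ^ d1 \<rho>)) $ k"
    \<comment> \<open>Coefficient \<open>k\<close> of a product involves only coefficients up to
      \<open>k\<close> of its factors, and these see only the parts up to \<open>k\<close>.\<close>
    using partition_gf_kappa1_finite[of "{0<..k}" q]
    by (simp add: fps_mult_nth partition_gf_nth_truncate[where k = k])
qed

section \<open>From partitions to multi-partitions\<close>

lemma multipartitions_of_Suc:
  "multipartitions_of (Suc n) k =
    (\<lambda>(i, \<rho>, ps). \<rho> # ps) ` (SIGMA i:{0..k}. partitions_into {0<..} i \<times> multipartitions_of n (k - i))"
  (is "?L = ?f ` ?R")
proof (intro equalityI subsetI)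
  fix ps assume "ps \<in> ?L"
  then obtain \<rho> qs where "ps = \<rho> # qs" "0 \<notin># \<rho>" "\<forall>\<rho>\<in>set qs. is_partition \<rho>" "length qs = n"
      "sum_mset \<rho> + weight qs = k"
    by (cases ps)
      (auto simp: multipartitions_of_def multipartitions_def is_partition_def weight_def)
  then have "ps = ?f (sum_mset \<rho>, \<rho>, qs)" "(sum_mset \<rho>, \<rho>, qs) \<in> ?R"
    by (auto simp: multipartitions_of_def multipartitions_def partitions_into_def intro: gr0I)
  then show "ps \<in> ?f ` ?R" by blast
qed (auto simp: multipartitions_of_def multipartitions_def is_partition_def weight_def
    partitions_into_def)

text \<open>The components are chosen independently, so splitting off the first one gives a Cauchy
  product with one more factor.\<close>

lemma sum_multipartitions_of:
  fixes w :: "nat multiset \<Rightarrow> 'a::field"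
  shows "(\<Sum>ps\<in>multipartitions_of n k. \<Prod>\<rho>\<leftarrow>ps. w \<rho>) = (partition_gf {0<..} w ^ n) $ k"
proof (induction n arbitrary: k)
  case 0
  have "multipartitions_of 0 k = (if k = 0 then {[]} else {})"
    by (auto simp: multipartitions_of_def multipartitions_def weight_def)
  then show ?case by simp
next
  case (Suc n)
  let ?R = "SIGMA i:{0..k}. partitions_into {0<..} i \<times> multipartitions_of n (k - i)"
  \<comment> \<open>Forgetting \<open>i\<close> is harmless, since it is the sum of
    \<open>\<rho>\<close>.\<close>
  have "inj_on (\<lambda>(i, \<rho>, ps). \<rho> # ps) ?R"
    by (auto simp: inj_on_def partitions_into_def)
  then have "(\<Sum>ps\<in>multipartitions_of (Suc n) k. \<Prod>\<rho>\<leftarrow>ps. w \<rho>) =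
      (\<Sum>(i, \<rho>, ps)\<in>?R. w \<rho> * (\<Prod>\<rho>\<leftarrow>ps. w \<rho>))"
    unfolding multipartitions_of_Suc by (subst sum.reindex) (auto intro!: sum.cong)
  also have "\<dots> = (\<Sum>i=0..k. \<Sum>(\<rho>, ps)\<in>partitions_into {0<..} i \<times> multipartitions_of n (k - i).
      w \<rho> * (\<Prod>\<rho>\<leftarrow>ps. w \<rho>))"
    by (subst sum.Sigma) (auto intro: finite_partitions_into finite_multipartitions_of)
  also have "\<dots> = (\<Sum>i=0..k. partition_gf {0<..} w $ i * (partition_gf {0<..} w ^ n) $ (k - i))"
    by (simp add: partition_gf_nth sum_product sum.cartesian_product flip: Suc.IH)
  finally show ?case
    by (simp add: fps_mult_nth)
qed

text \<open>Reconciles the separately defined value 1 of \<open>epsilon\<close> and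
  \<open>p_sum\<close> at \<open>k = 0\<close> with the constant coefficient.\<close>

lemma partition_gf_power_nth_0:
  assumes "w {#} = 1"
  shows "(partition_gf {0<..} w ^ n) $ 0 = 1"
proof -
  have "partitions_into {0<..} 0 = {{#}}"
    by (auto simp: partitions_into_def) (metis less_irrefl multiset_nonemptyE subsetD greaterThan_iff)
  then show ?thesis
    using assms by (simp add: partition_gf_def fps_nth_power_0)
qed

lemma epsilon_eq_nth: "epsilon q n k = (partition_gf {0<..} (kappa1 q) ^ n) $ k"
proof -
  have "kappa1 q {#} = 1"
    by (simp add: kappa1_def)
  then show ?thesis
    by (simp add: epsilon_def kappa_def sum_multipartitions_of partition_gf_power_nth_0)
qed

lemma p_sum_eq_nth:
  "p_sum q n k = (partition_gf {0<..} (\<lambda>\<rho>. (1 - inverse q) ^ d1 \<rho>) ^ n) $ k"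
proof -
  have "(1 - inverse q) ^ d ps = (\<Prod>\<rho>\<leftarrow>ps. (1 - inverse q) ^ d1 \<rho>)" for ps
    by (induction ps) (simp_all add: d_def power_add)
  then show ?thesis
    by (simp add: p_sum_def sum_multipartitions_of partition_gf_power_nth_0 d1_def)
qed

theorem proposition3p8:
  fixes n k :: nat
  assumes "n \<ge> 1" and "k > 0"
  shows "epsilon (indet :: 'a::idom poly fract) n k =
    (\<Sum>r=0..k. epsilon 1 n r * p_sum indet n (k - r))"
proof -
  let ?q = "indet :: 'a poly fract"
  have "epsilon ?q n k = ((partition_gf {0<..} (kappa1 1) *
      partition_gf {0<..} (\<lambda>\<rho>. (1 - inverse ?q) ^ d1 \<rho>)) ^ n) $ k"
    by (simp add: epsilon_eq_nth flip: partition_gf_kappa1)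
  \<comment> \<open>The power of the product is the product of the powers; its coefficient at
    \<open>k\<close> is the claimed convolution.\<close>
  then show ?thesis
    by (simp add: power_mult_distrib fps_mult_nth epsilon_eq_nth p_sum_eq_nth)
qed

end
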